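(* For every infinitely-ended group $G$, the end weight of $G$ is $\ge |G|$.
   Context: A subset $A$ of a group $G$ is left $G$-commensurated if $gA\bigtriangleup A$ is finite for every $g\in G$. These subsets form a Boolean subalgebra $\mathcal{P}_{(G)}(G)$ of the power set of $G$; $\mathcal{P}^\star_G(G)$ denotes its quotient by the ideal of finite subsets of $G$. The space of ends $\mathcal{E}^\star(G)$ is the Stone dual of $\mathcal{P}^\star_G(G)$, i.e. the compact Hausdorff totally disconnected space whose Boolean algebra of clopen subsets is $\mathcal{P}^\star_G(G)$. $G$ is infinitely-ended if $\mathcal{P}^\star_G(G)$ is infinite. The end weight of $G$ is the weight (smallest cardinal of a basis of the topology) of $\mathcal{E}^\star(G)$; it equals the dimension of $\mathcal{P}^\star_G(G)$ as a vector space over $\mathbf{Z}/2\mathbf{Z}$, which, when infinite, is the cardinal of $\mathcal{P}^\star_G(G)$. *)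

theory Defs
  imports
    "HOL-Analysis.Analysis"
    "HOL-Algebra.QuotRing"
begin

definition topology_base :: "'a topology \<Rightarrow> 'a set set \<Rightarrow> bool" where
  "topology_base X \<B> \<longleftrightarrow>
     (\<forall>V\<in>\<B>. openin X V) \<and>
     (\<forall>U x. openin X U \<and> x \<in> U \<longrightarrow> (\<exists>V\<in>\<B>. x \<in> V \<and> V \<subseteq> U))"

text \<open>Cardinals are cardinal orders, compared by
  \<^const>\<open>ordLeq\<close> up to order isomorphism; the choice of the minimal base below
  therefore does not matter.\<close>

definition weight :: "'a topology \<Rightarrow> 'a set rel" where
  "weight X = card_of (SOME \<B>. topology_base X \<B> \<and>
     (\<forall>\<B>'. topology_base X \<B>' \<longrightarrow> (card_of \<B>, card_of \<B>') \<in> ordLeq))"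

lemma topology_base_openin: "topology_base X {U. openin X U}"
  by (auto simp: topology_base_def)

lemma weight_attained_and_least:
  shows "\<exists>\<B>. topology_base X \<B> \<and> weight X = card_of \<B>"
    and "topology_base X \<B>' \<Longrightarrow> (weight X, card_of \<B>') \<in> ordLeq"
proof -
  let ?R = "card_of ` {\<B>. topology_base X \<B>}"
  have "?R \<noteq> {}" using topology_base_openin by blast
  moreover have "\<forall>r\<in>?R. Card_order r" by (auto simp: card_of_Card_order)
  ultimately obtain r where "r \<in> ?R" "\<forall>r'\<in>?R. (r, r') \<in> ordLeq"
    using exists_minim_Card_order[of ?R] by blast
  then have ex: "\<exists>\<B>. topology_base X \<B> \<and>
      (\<forall>\<B>'. topology_base X \<B>' \<longrightarrow> (card_of \<B>, card_of \<B>') \<in> ordLeq)"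
    by auto
  from someI_ex[OF ex] show "\<exists>\<B>. topology_base X \<B> \<and> weight X = card_of \<B>"
    unfolding weight_def by blast
  from someI_ex[OF ex] show "topology_base X \<B>' \<Longrightarrow> (weight X, card_of \<B>') \<in> ordLeq"
    unfolding weight_def by blast
qed

text \<open>Boolean algebras are treated as Boolean rings (\<open>\<oplus>\<close> is symmetric difference, \<open>\<otimes>\<close> is
  meet). The points of the Stone dual are the maximal ideals, that is, the complements of the
  ultrafilters; the element \<open>a\<close> of the algebra corresponds to the clopen set of those points
  whose ultrafilter contains \<open>a\<close>.\<close>

definition stone_clopen :: "('a, 'b) ring_scheme \<Rightarrow> 'a \<Rightarrow> 'a set set" where
  "stone_clopen R a = {M. maximalideal M R \<and> a \<notin> M}"

definition stone_dual :: "('a, 'b) ring_scheme \<Rightarrow> 'a set topology" where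
  "stone_dual R = topology_generated_by (stone_clopen R ` carrier R)"

definition left_commensurated :: "('a, 'b) monoid_scheme \<Rightarrow> 'a set \<Rightarrow> bool" where
  "left_commensurated G A \<longleftrightarrow>
     A \<subseteq> carrier G \<and> (\<forall>g\<in>carrier G. finite (sym_diff (g <#\<^bsub>G\<^esub> A) A))"

definition comm_algebra :: "('a, 'b) monoid_scheme \<Rightarrow> 'a set ring" where
  "comm_algebra G =
     \<lparr>carrier = {A. left_commensurated G A}, mult = (\<inter>), one = carrier G,
      zero = {}, add = sym_diff\<rparr>"

definition finite_ideal :: "('a, 'b) monoid_scheme \<Rightarrow> 'a set set" where
  "finite_ideal G = {A. A \<subseteq> carrier G \<and> finite A}"

definition ends_algebra :: "('a, 'b) monoid_scheme \<Rightarrow> 'a set set ring" where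
  "ends_algebra G = comm_algebra G Quot finite_ideal G"

definition ends_space :: "('a, 'b) monoid_scheme \<Rightarrow> 'a set set set topology" where
  "ends_space G = stone_dual (ends_algebra G)"

definition infinitely_ended :: "('a, 'b) monoid_scheme \<Rightarrow> bool" where
  "infinitely_ended G \<longleftrightarrow> infinite (carrier (ends_algebra G))"

definition end_weight :: "('a, 'b) monoid_scheme \<Rightarrow> 'a set set set set rel" where
  "end_weight G = weight (ends_space G)"

lemma (in group) l_coset_sym_diff:
  assumes "A \<subseteq> carrier G" "B \<subseteq> carrier G" "g \<in> carrier G"
  shows "g <# (sym_diff A B) = sym_diff (g <# A) (g <# B)"
    and "g <# (A \<inter> B) = (g <# A) \<inter> (g <# B)"
proof -
  have inj: "inj_on (\<lambda>h. g \<otimes> h) (carrier G)" using assms(3) by (simp add: inj_on_def)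
  have im: "g <# C = (\<lambda>h. g \<otimes> h) ` C" for C by (auto simp: l_coset_def)
  have "A - B \<subseteq> carrier G" "B - A \<subseteq> carrier G" using assms by auto
  then show "g <# (sym_diff A B) = sym_diff (g <# A) (g <# B)"
    unfolding im image_Un using inj_on_image_set_diff[OF inj] assms by metis
  show "g <# (A \<inter> B) = (g <# A) \<inter> (g <# B)"
    unfolding im using inj_on_image_Int[OF inj] assms by metis
qed

lemma (in group) left_commensurated_closed:
  assumes "left_commensurated G A" "left_commensurated G B"
  shows "left_commensurated G (sym_diff A B)" and "left_commensurated G (A \<inter> B)"
proof -
  have sub: "A \<subseteq> carrier G" "B \<subseteq> carrier G"
    using assms by (auto simp: left_commensurated_def)
  have fin: "finite (sym_diff (g <# A) A \<union> sym_diff (g <# B) B)" if "g \<in> carrier G" for g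
    using assms that by (auto simp: left_commensurated_def)
  have "finite (sym_diff (g <# (sym_diff A B)) (sym_diff A B))" if g: "g \<in> carrier G" for g
    by (rule finite_subset[OF _ fin[OF g]]) (auto simp: l_coset_sym_diff(1)[OF sub g])
  then show "left_commensurated G (sym_diff A B)"
    using sub by (auto simp: left_commensurated_def)
  have "finite (sym_diff (g <# (A \<inter> B)) (A \<inter> B))" if g: "g \<in> carrier G" for g
    by (rule finite_subset[OF _ fin[OF g]]) (auto simp: l_coset_sym_diff(2)[OF sub g])
  then show "left_commensurated G (A \<inter> B)"
    using sub by (auto simp: left_commensurated_def)
qed

lemma (in group) left_commensurated_finite:
  assumes "A \<subseteq> carrier G" "finite A"
  shows "left_commensurated G A"
  using assms by (auto simp: left_commensurated_def l_coset_def)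

lemma (in group) left_commensurated_carrier: "left_commensurated G (carrier G)"
proof -
  have "g <# carrier G = carrier G" if "g \<in> carrier G" for g
    using that coset_join3 subgroup_self by blast
  then show ?thesis by (simp add: left_commensurated_def)
qed

lemma (in group) cring_comm_algebra: "cring (comm_algebra G)"
proof (rule cringI)
  have e: "left_commensurated G {}" by (rule left_commensurated_finite) auto
  show "abelian_group (comm_algebra G)"
  proof (rule abelian_groupI)
    fix x assume "x \<in> carrier (comm_algebra G)"
    then show "\<exists>y\<in>carrier (comm_algebra G). y \<oplus>\<^bsub>comm_algebra G\<^esub> x = \<zero>\<^bsub>comm_algebra G\<^esub>"
      by (auto simp: comm_algebra_def)
  qed (use e left_commensurated_closed in \<open>auto simp: comm_algebra_def\<close>)
  show "comm_monoid (comm_algebra G)"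
    by (rule comm_monoidI)
      (use left_commensurated_carrier left_commensurated_closed in
        \<open>auto simp: comm_algebra_def left_commensurated_def\<close>)
qed (auto simp: comm_algebra_def)

lemma (in group) ideal_finite_ideal: "ideal (finite_ideal G) (comm_algebra G)"
proof -
  interpret P: cring "comm_algebra G" by (rule cring_comm_algebra)
  have "\<ominus>\<^bsub>comm_algebra G\<^esub> A = A" if "left_commensurated G A" for A
    by (rule P.minus_equality) (use that in \<open>auto simp: comm_algebra_def\<close>)
  then have inv: "inv\<^bsub>add_monoid (comm_algebra G)\<^esub> A = A" if "left_commensurated G A" for A
    using that by (simp add: a_inv_def)
  show ?thesis
  proof (rule idealI)
    show "ring (comm_algebra G)" by (rule P.ring_axioms)
    show "subgroup (finite_ideal G) (add_monoid (comm_algebra G))"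
      by (rule subgroup.intro)
        (use left_commensurated_finite inv in
          \<open>auto simp: finite_ideal_def comm_algebra_def\<close>)
  qed (auto simp: finite_ideal_def comm_algebra_def)
qed

lemma (in group) cring_ends_algebra: "cring (ends_algebra G)"
  unfolding ends_algebra_def
  by (rule ideal.quotient_is_cring[OF ideal_finite_ideal cring_comm_algebra])

end

theory Submission
  imports
    Defs
    "HOL-Algebra.Ring_Divisibility"
    "HOL-Library.Countable_Set_Type"
begin

text \<open>
  The end weight is at least the cardinality of the infinite algebra of ends, because the Stone dual of a
  Boolean ring has one compact open set for each element of the ring
  (\<open>inj_stone_clopen\<close>, \<open>compactin_stone_clopen\<close>), and a compact open set is a union of finitely
  many members of any given base. An infinite base therefore has at least as many members as
  there are compact open sets (\<open>card_compact_open_ordLeq_base\<close>).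

  It remains to find \<open>|G|\<close> elements in the algebra of ends. If this algebra is infinite, then
  there is a left commensurated set \<open>A\<close> that is neither finite nor cofinite. Right translates of
  left commensurated sets are left commensurated, so \<open>g \<mapsto> [A g]\<close> maps \<open>G\<close> to the algebra of ends.
  The point is that its fibres are countable (\<open>countable_almost_equal_translates\<close>); as the algebra
  is infinite, \<open>G\<close> is then a union of at most \<open>|algebra|\<close> many countable sets, and has at most the
  cardinality of the algebra.

  For the countability of the fibres, call \<open>{y. y \<in> A \<noteq> x y \<in> A}\<close> the boundary of \<open>A\<close> at \<open>x\<close>; it is
  finite. Closing off a countable set under multiplication, inverses and boundaries gives a
  countable subgroup \<open>D\<close> which meets both \<open>A\<close> and its complement in infinite sets and contains the
  boundaries at all of its elements. Outside \<open>D\<close>, membership in \<open>A\<close> is then invariant under left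
  multiplication by \<open>D\<close>, so each coset \<open>D k\<close> other than \<open>D\<close> is contained in \<open>A\<close> or disjoint from
  it. Hence, for \<open>k \<notin> D\<close>, the translate of \<open>A\<close> by \<open>inv k\<close> contains \<open>D\<close> or misses it, and
  cannot agree with \<open>A\<close> up to a finite set. So translates by elements of different cosets of
  \<open>D\<close> are never almost equal.
\<close>

section \<open>Compact open sets and bases\<close>

lemma card_of_finite_subsets_ordLeq:
  assumes "infinite B"
  shows "(card_of (Fpow B), card_of B) \<in> ordLeq"
proof -
  let ?P = "\<lambda>n. {F. F \<subseteq> B \<and> finite F \<and> card F = n}"
  have le: "(card_of (?P n), card_of B) \<in> ordLeq" for n
  proof (induction n)
    case 0
    have P0: "?P 0 = {{}}" by auto
    have "B \<noteq> {}" using assms by auto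
    then show ?case unfolding P0 by (rule card_of_singl_ordLeq)
  next
    case (Suc n)
    have "?P (Suc n) \<subseteq> (\<lambda>(x, F). insert x F) ` (B \<times> ?P n)"
    proof
      fix F assume F: "F \<in> ?P (Suc n)"
      then obtain x F' where "F = insert x F'" "x \<notin> F'" "card F' = n"
        by (auto simp: card_Suc_eq)
      with F show "F \<in> (\<lambda>(x, F). insert x F) ` (B \<times> ?P n)"
        by (auto intro!: image_eqI[of _ _ "(x, F')"])
    qed
    then have "(card_of (?P (Suc n)), card_of (B \<times> ?P n)) \<in> ordLeq"
      by (rule surj_imp_ordLeq)
    also have "(card_of (B \<times> ?P n), card_of B) \<in> ordLeq"
      using card_of_Sigma_ordLeq_infinite[OF assms ordLeq_refl[OF card_of_Card_order], of "\<lambda>_. ?P n"] Suc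
      by simp
    finally (ordLeq_transitive) show ?case .
  qed
  have "Fpow B = (\<Union>n\<in>UNIV. ?P n)" by (auto simp: Fpow_def)
  moreover have "(card_of (UNIV :: nat set), card_of B) \<in> ordLeq"
    using assms by (simp add: infinite_iff_card_of_nat)
  ultimately show ?thesis
    using card_of_UNION_ordLeq_infinite[OF assms, of UNIV ?P] le by simp
qed

text \<open>Each compact open set is covered by finitely many of the base members inside it, hence it
  is determined by a finite subset of the base.\<close>

lemma card_compact_open_ordLeq_base:
  assumes "topology_base X B"
    and inf: "infinite K"
    and K: "\<And>U. U \<in> K \<Longrightarrow> openin X U \<and> compactin X U"
  shows "(card_of K, card_of B) \<in> ordLeq"
proof -
  have sub: "K \<subseteq> Union ` Fpow B"
  proof
    fix U assume "U \<in> K"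
    then have U: "openin X U" "compactin X U" using K by auto
    let ?C = "{V \<in> B. V \<subseteq> U}"
    have "U \<subseteq> \<Union>?C"
    proof
      fix x assume "x \<in> U"
      with assms(1) U(1) obtain V where "V \<in> B" "x \<in> V" "V \<subseteq> U"
        unfolding topology_base_def by meson
      then show "x \<in> \<Union>?C" by auto
    qed
    moreover have "\<forall>V\<in>?C. openin X V" using assms(1) by (auto simp: topology_base_def)
    ultimately obtain F where F: "finite F" "F \<subseteq> ?C" "U \<subseteq> \<Union>F"
      using U(2) unfolding compactin_def by meson
    then have "U = \<Union>F" by auto
    with F show "U \<in> Union ` Fpow B" by (auto simp: Fpow_def)
  qed
  have "infinite B"
  proof
    assume "finite B"
    then have "finite (Fpow B)" by (meson Fpow_subset_Pow finite_Pow_iff finite_subset)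
    with sub inf show False by (meson finite_imageI finite_subset)
  qed
  then show ?thesis
    using surj_imp_ordLeq[OF sub] card_of_finite_subsets_ordLeq ordLeq_transitive by blast
qed

section \<open>Stone duals of Boolean rings\<close>

locale boolean_ring = cring +
  assumes idem: "a \<in> carrier R \<Longrightarrow> a \<otimes> a = a"
begin

text \<open>Among the ideals that contain \<open>J\<close> but not \<open>a\<close>, a maximal one \<open>M\<close> exists by Zorn's lemma. It is
  a maximal ideal outright: \<open>a\<close> annihilates its complement \<open>1 - a\<close>, so adjoining \<open>1 - a\<close> to \<open>M\<close>
  cannot produce \<open>a\<close>, and therefore \<open>1 - a \<in> M\<close>. Any larger ideal then contains both \<open>a\<close> and
  \<open>1 - a\<close>.\<close>

lemma maximal_ideal_avoiding:
  assumes J: "ideal J R" and a: "a \<in> carrier R" "a \<notin> J"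
  shows "\<exists>M. maximalideal M R \<and> J \<subseteq> M \<and> a \<notin> M"
proof -
  let ?S = "{I. ideal I R \<and> J \<subseteq> I \<and> a \<notin> I}"
  have "\<exists>M\<in>?S. \<forall>I\<in>?S. M \<subseteq> I \<longrightarrow> I = M"
  proof (rule subset_Zorn_nonempty)
    show "?S \<noteq> {}" using J a by auto
    fix C assume C: "C \<noteq> {}" "subset.chain ?S C"
    then have "subset.chain {I. ideal I R} C" by (auto simp: subset_chain_def)
    from chain_Union_is_ideal[OF this] C(1) have "ideal (\<Union>C) R" by simp
    with C show "\<Union>C \<in> ?S" by (auto simp: subset_chain_def)
  qed
  then obtain M where M: "ideal M R" "J \<subseteq> M" "a \<notin> M"
    and maxS: "\<forall>I\<in>?S. M \<subseteq> I \<longrightarrow> I = M"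
    by blast
  have max: "I = M" if "ideal I R" "M \<subseteq> I" "a \<notin> I" for I
    using maxS M(2) that by blast
  interpret M: ideal M R by (rule M(1))
  let ?b = "\<one> \<ominus> a"
  have b: "?b \<in> carrier R" using a by simp
  have "?b \<in> M"
  proof (rule ccontr)
    assume nb: "?b \<notin> M"
    have id: "ideal (M <+> PIdl ?b) R"
      using add_ideals[OF M(1) cgenideal_ideal[OF b]] .
    have "M \<subseteq> M <+> PIdl ?b"
    proof
      fix m assume m: "m \<in> M"
      have "\<zero> \<in> PIdl ?b"
        using additive_subgroup.zero_closed[OF ideal.axioms(1)[OF cgenideal_ideal[OF b]]] .
      with m have "m \<oplus> \<zero> \<in> M <+> PIdl ?b" unfolding set_add_def' by blast
      then show "m \<in> M <+> PIdl ?b" using m M.Icarr by simp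
    qed
    moreover have "\<zero> \<oplus> ?b \<in> M <+> PIdl ?b"
      using M.zero_closed cgenideal_self[OF b] unfolding set_add_def' by blast
    ultimately have "a \<in> M <+> PIdl ?b" using max[OF id] nb b by auto
    then obtain m r where mr: "m \<in> M" "r \<in> carrier R" "a = m \<oplus> r \<otimes> ?b"
      by (auto simp: set_add_def' cgenideal_def)
    have mc: "m \<in> carrier R" using mr(1) by (rule M.Icarr)
    have "?b \<otimes> a = \<zero>" using a idem[OF a(1)] by (simp add: minus_eq l_distr l_minus r_neg)
    then have "(m \<oplus> r \<otimes> ?b) \<otimes> a = m \<otimes> a"
      using mr(2) mc a b by (simp add: l_distr m_assoc del: minus_eq)
    then have "a = m \<otimes> a" using mr(3) idem[OF a(1)] by simp
    with M.I_r_closed[OF mr(1) a(1)] M(3) show False by simp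
  qed
  have "maximalideal M R"
  proof (rule maximalidealI[OF M(1)])
    show "carrier R \<noteq> M" using a M(3) by auto
    fix I assume I: "ideal I R" "M \<subseteq> I" "I \<subseteq> carrier R"
    interpret I: ideal I R by (rule I(1))
    show "I = M \<or> I = carrier R"
    proof (cases "a \<in> I")
      case True
      have "?b \<oplus> a \<in> I" using \<open>?b \<in> M\<close> I(2) True by (intro I.a_closed) auto
      moreover have "?b \<oplus> a = \<one>" using a by (simp add: minus_eq a_assoc l_neg)
      ultimately show ?thesis using I.one_imp_carrier by simp
    qed (use max I in auto)
  qed
  with M show ?thesis by auto
qed

lemma stone_clopen_mult:
  assumes "x \<in> carrier R" "y \<in> carrier R"
  shows "stone_clopen R (x \<otimes> y) = stone_clopen R x \<inter> stone_clopen R y"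
proof -
  have "x \<otimes> y \<in> M \<longleftrightarrow> x \<in> M \<or> y \<in> M" if "maximalideal M R" for M
  proof -
    interpret primeideal M R using maximalideal_prime[OF that] .
    show ?thesis using assms I_prime I_l_closed I_r_closed by blast
  qed
  then show ?thesis by (auto simp: stone_clopen_def)
qed

lemma stone_clopen_add:
  assumes "x \<in> carrier R" "y \<in> carrier R"
  shows "stone_clopen R (x \<oplus> y) \<subseteq> stone_clopen R x \<union> stone_clopen R y"
proof -
  have "x \<oplus> y \<in> M" if M: "maximalideal M R" and xy: "x \<in> M" "y \<in> M" for M
  proof -
    interpret M: maximalideal M R by (rule M)
    show ?thesis using xy by (rule M.a_closed)
  qed
  then show ?thesis by (auto simp: stone_clopen_def)
qed

text \<open>If the clopen set of \<open>x\<close> lies in that of \<open>y\<close>, then no maximal ideal contains \<open>y\<close> but not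
  \<open>x\<close>; hence \<open>x\<close> is a multiple of \<open>y\<close>, which in a Boolean ring means \<open>x y = x\<close>.\<close>

lemma inj_stone_clopen: "inj_on (stone_clopen R) (carrier R)"
proof -
  have *: "x \<otimes> y = x"
    if xy: "x \<in> carrier R" "y \<in> carrier R" "stone_clopen R x \<subseteq> stone_clopen R y" for x y
  proof -
    have "x \<in> PIdl y"
    proof (rule ccontr)
      assume "x \<notin> PIdl y"
      from maximal_ideal_avoiding[OF cgenideal_ideal[OF xy(2)] xy(1) this] xy(3)
      show False using cgenideal_self[OF xy(2)] by (auto simp: stone_clopen_def)
    qed
    then obtain r where "r \<in> carrier R" "x = r \<otimes> y" by (auto simp: cgenideal_def)
    then show ?thesis using idem xy(2) by (simp add: m_assoc)
  qed
  show ?thesis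
  proof (rule inj_onI)
    fix x y assume "x \<in> carrier R" "y \<in> carrier R" "stone_clopen R x = stone_clopen R y"
    with *[of x y] *[of y x] show "x = y" by (metis m_comm order_refl)
  qed
qed

lemma openin_stone_clopen: "a \<in> carrier R \<Longrightarrow> openin (stone_dual R) (stone_clopen R a)"
  unfolding stone_dual_def by (rule topology_generated_by_Basis) auto

lemma stone_dual_clopen_neighbourhood:
  assumes "openin (stone_dual R) V" "M \<in> V"
  shows "\<exists>b\<in>carrier R. M \<in> stone_clopen R b \<and> stone_clopen R b \<subseteq> V"
proof -
  have "generate_topology_on (stone_clopen R ` carrier R) V"
    using assms(1) unfolding stone_dual_def by (rule openin_topology_generated_by)
  from this assms(2) show ?thesis
  proof (induction arbitrary: M)
    case (Int V W)
    then obtain b c where "b \<in> carrier R" "M \<in> stone_clopen R b" "stone_clopen R b \<subseteq> V"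
      "c \<in> carrier R" "M \<in> stone_clopen R c" "stone_clopen R c \<subseteq> W" by (meson IntE)
    then show ?case by (intro bexI[of _ "b \<otimes> c"]) (auto simp: stone_clopen_mult)
  next
    case (UN K)
    then show ?case by (meson Sup_upper UnionE order_trans)
  qed auto
qed

text \<open>For an open cover \<open>\<V>\<close>, the elements whose clopen sets are finitely covered form an ideal \<open>J\<close>.
  If it did not contain \<open>a\<close>, then some point \<open>M \<supseteq> J\<close> would lie in the clopen set of \<open>a\<close>, hence in a
  member \<open>V\<close> of the cover, and in a basic clopen set inside \<open>V\<close>. The element \<open>b\<close> defining that
  clopen set belongs to \<open>J \<subseteq> M\<close>, whereas \<open>M\<close> being in the clopen set of \<open>b\<close> means \<open>b \<notin> M\<close>.\<close>

lemma compactin_stone_clopen: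
  assumes a: "a \<in> carrier R"
  shows "compactin (stone_dual R) (stone_clopen R a)"
  unfolding compactin_def
proof (intro conjI allI impI)
  show "stone_clopen R a \<subseteq> topspace (stone_dual R)"
    using openin_stone_clopen[OF a] by (rule openin_subset)
  fix \<V> assume "(\<forall>V\<in>\<V>. openin (stone_dual R) V) \<and> stone_clopen R a \<subseteq> \<Union>\<V>"
  then have opn: "\<And>V. V \<in> \<V> \<Longrightarrow> openin (stone_dual R) V" and cov: "stone_clopen R a \<subseteq> \<Union>\<V>"
    by auto
  define J where
    "J = {x \<in> carrier R. \<exists>\<F>. finite \<F> \<and> \<F> \<subseteq> \<V> \<and> stone_clopen R x \<subseteq> \<Union>\<F>}"
  have down: "x \<in> J"
    if "x \<in> carrier R" "y \<in> J" "stone_clopen R x \<subseteq> stone_clopen R y" for x y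
    using that unfolding J_def by blast
  have "ideal J R"
  proof (rule idealI)
    show "ring R" by (rule ring_axioms)
    show "subgroup J (add_monoid R)"
    proof (rule add.subgroupI)
      show "J \<subseteq> carrier R" by (auto simp: J_def)
      have "\<zero> \<in> M" if "maximalideal M R" for M
        using additive_subgroup.zero_closed[OF ideal.axioms(1)[OF maximalideal.axioms(1)[OF that]]] .
      then have "stone_clopen R \<zero> = {}" by (auto simp: stone_clopen_def)
      then have "\<zero> \<in> J" by (auto simp: J_def)
      then show "J \<noteq> {}" by auto
    next
      fix x assume x: "x \<in> J"
      then have xc: "x \<in> carrier R" by (simp add: J_def)
      have "\<ominus> x = \<ominus> \<one> \<otimes> x" using xc by (simp add: l_minus)
      then have "stone_clopen R (\<ominus> x) \<subseteq> stone_clopen R x"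
        using stone_clopen_mult[of "\<ominus> \<one>" x] xc by simp
      with x xc show "\<ominus> x \<in> J" using down[of "\<ominus> x" x] by simp
    next
      fix x y assume "x \<in> J" "y \<in> J"
      then obtain F F' where "x \<in> carrier R" "finite F" "F \<subseteq> \<V>" "stone_clopen R x \<subseteq> \<Union>F"
        "y \<in> carrier R" "finite F'" "F' \<subseteq> \<V>" "stone_clopen R y \<subseteq> \<Union>F'"
        by (auto simp: J_def)
      moreover from this have "stone_clopen R (x \<oplus> y) \<subseteq> \<Union>(F \<union> F')"
        using stone_clopen_add[of x y] by blast
      ultimately show "x \<oplus> y \<in> J" unfolding J_def
        by (intro CollectI conjI exI[of _ "F \<union> F'"]) auto
    qed
    fix x y assume "x \<in> J" "y \<in> carrier R"
    moreover from this have "x \<in> carrier R" by (simp add: J_def)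
    ultimately show "y \<otimes> x \<in> J" "x \<otimes> y \<in> J"
      by (auto intro!: down[of _ x] simp: stone_clopen_mult)
  qed
  have "a \<in> J"
  proof (rule ccontr)
    assume "a \<notin> J"
    then obtain M where M: "maximalideal M R" "J \<subseteq> M" "a \<notin> M"
      using maximal_ideal_avoiding[OF \<open>ideal J R\<close> a] by auto
    then obtain V where V: "V \<in> \<V>" "M \<in> V" using cov by (auto simp: stone_clopen_def)
    then obtain b where b: "b \<in> carrier R" "M \<in> stone_clopen R b" "stone_clopen R b \<subseteq> V"
      using stone_dual_clopen_neighbourhood[OF opn[OF V(1)] V(2)] by auto
    then have "b \<in> J" using V(1) by (auto simp: J_def intro!: exI[of _ "{V}"])
    with b(2) M(2) show False by (auto simp: stone_clopen_def)
  qed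
  then show "\<exists>\<F>. finite \<F> \<and> \<F> \<subseteq> \<V> \<and> stone_clopen R a \<subseteq> \<Union>\<F>" by (simp add: J_def)
qed

lemma card_carrier_ordLeq_weight_stone_dual:
  assumes "infinite (carrier R)"
  shows "(card_of (carrier R), weight (stone_dual R)) \<in> ordLeq"
proof -
  obtain B where B: "topology_base (stone_dual R) B" "weight (stone_dual R) = card_of B"
    using weight_attained_and_least(1) by blast
  have "infinite (stone_clopen R ` carrier R)"
    using assms finite_image_iff[OF inj_stone_clopen] by simp
  then have "(card_of (stone_clopen R ` carrier R), card_of B) \<in> ordLeq"
    by (rule card_compact_open_ordLeq_base[OF B(1)])
      (use openin_stone_clopen compactin_stone_clopen in auto)
  moreover have "(card_of (carrier R), card_of (stone_clopen R ` carrier R)) \<in> ordLeq"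
    using inj_stone_clopen card_of_ordLeqI by blast
  ultimately show ?thesis using B(2) ordLeq_transitive by metis
qed

end

section \<open>Almost equal right translates\<close>

lemma countable_closure:
  fixes f :: "'a \<Rightarrow> 'a \<Rightarrow> 'a set"
  assumes "countable S" "S \<subseteq> X"
    and f: "\<And>x y. x \<in> X \<Longrightarrow> y \<in> X \<Longrightarrow> countable (f x y) \<and> f x y \<subseteq> X"
  shows "\<exists>D. countable D \<and> S \<subseteq> D \<and> D \<subseteq> X \<and> (\<forall>x\<in>D. \<forall>y\<in>D. f x y \<subseteq> D)"
proof -
  define E where "E = rec_nat S (\<lambda>_ D. D \<union> (\<Union>x\<in>D. \<Union>y\<in>D. f x y))"
  have E0: "E 0 = S" and ES: "E (Suc n) = E n \<union> (\<Union>x\<in>E n. \<Union>y\<in>E n. f x y)" for n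
    by (simp_all add: E_def)
  have inv: "countable (E n) \<and> E n \<subseteq> X" for n
  proof (induction n)
    case (Suc n)
    then have "countable (f x y) \<and> f x y \<subseteq> X" if "x \<in> E n" "y \<in> E n" for x y
      using f that by blast
    with Suc show ?case unfolding ES by (auto intro!: countable_UN)
  qed (use assms E0 in auto)
  have mono: "m \<le> n \<Longrightarrow> E m \<subseteq> E n" for m n
    by (rule lift_Suc_mono_le[of E]) (auto simp: ES)
  have closed: "f x y \<subseteq> (\<Union>n. E n)" if xy: "x \<in> E m" "y \<in> E n" for x y m n
  proof -
    have "x \<in> E (max m n)" "y \<in> E (max m n)"
      using xy mono[of m "max m n"] mono[of n "max m n"] by auto
    then have "f x y \<subseteq> E (Suc (max m n))" unfolding ES by blast
    then show ?thesis by blast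
  qed
  show ?thesis
  proof (intro exI[of _ "\<Union>n. E n"] conjI ballI)
    show "countable (\<Union>n. E n)" "(\<Union>n. E n) \<subseteq> X" using inv by auto
    show "S \<subseteq> (\<Union>n. E n)" using E0 by auto
    fix x y assume "x \<in> (\<Union>n. E n)" "y \<in> (\<Union>n. E n)"
    then obtain m n where "x \<in> E m" "y \<in> E n" by auto
    then show "f x y \<subseteq> (\<Union>n. E n)" by (rule closed)
  qed
qed

context group
begin

lemma left_commensurated_r_coset:
  assumes A: "left_commensurated G A" and g: "g \<in> carrier G"
  shows "left_commensurated G (A #> g)"
  unfolding left_commensurated_def
proof (intro conjI ballI)
  have sub: "A \<subseteq> carrier G" using A by (simp add: left_commensurated_def)
  then show "A #> g \<subseteq> carrier G" using g by (rule r_coset_subset_G)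
  fix x assume x: "x \<in> carrier G"
  have "x <#\<^bsub>G\<^esub> (A #> g) = (x <#\<^bsub>G\<^esub> A) #> g" using coset_assoc[OF x g sub] by simp
  then have "sym_diff (x <#\<^bsub>G\<^esub> (A #> g)) (A #> g) \<subseteq> (\<lambda>y. y \<otimes> g) ` sym_diff (x <#\<^bsub>G\<^esub> A) A"
    by (auto simp: r_coset_def)
  moreover have "finite (sym_diff (x <#\<^bsub>G\<^esub> A) A)" using A x by (simp add: left_commensurated_def)
  ultimately show "finite (sym_diff (x <#\<^bsub>G\<^esub> (A #> g)) (A #> g))"
    by (rule finite_surj[rotated])
qed

lemma mem_r_coset_iff:
  assumes "A \<subseteq> carrier G" "g \<in> carrier G" "y \<in> carrier G"
  shows "y \<in> A #> g \<longleftrightarrow> y \<otimes> inv g \<in> A"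
proof
  assume "y \<in> A #> g"
  then obtain a where "a \<in> A" "y = a \<otimes> g" by (auto simp: r_coset_def)
  then show "y \<otimes> inv g \<in> A" using assms by (auto simp: m_assoc)
next
  assume "y \<otimes> inv g \<in> A"
  moreover have "y = y \<otimes> inv g \<otimes> g" using assms by (simp add: m_assoc)
  ultimately show "y \<in> A #> g" unfolding r_coset_def by blast
qed

lemma finite_boundary:
  assumes A: "left_commensurated G A" and x: "x \<in> carrier G"
  shows "finite {y \<in> carrier G. (y \<in> A) \<noteq> (x \<otimes> y \<in> A)}"
proof -
  have sub: "A \<subseteq> carrier G" using A by (simp add: left_commensurated_def)
  have inv: "inv x \<otimes> (x \<otimes> y) = y" if "y \<in> carrier G" for y
    using x that by (simp add: m_assoc[symmetric])
  have "{y \<in> carrier G. (y \<in> A) \<noteq> (x \<otimes> y \<in> A)} \<subseteq> sym_diff (inv x <#\<^bsub>G\<^esub> A) A"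
  proof
    fix y assume y: "y \<in> {y \<in> carrier G. (y \<in> A) \<noteq> (x \<otimes> y \<in> A)}"
    have "y \<in> inv x <#\<^bsub>G\<^esub> A \<longleftrightarrow> x \<otimes> y \<in> A"
    proof
      assume "y \<in> inv x <#\<^bsub>G\<^esub> A"
      then obtain a where "a \<in> A" "y = inv x \<otimes> a" by (auto simp: l_coset_def)
      then show "x \<otimes> y \<in> A" using x sub by (auto simp: m_assoc[symmetric])
    next
      assume "x \<otimes> y \<in> A"
      then show "y \<in> inv x <#\<^bsub>G\<^esub> A" using inv[of y] y by (force simp: l_coset_def)
    qed
    with y show "y \<in> sym_diff (inv x <#\<^bsub>G\<^esub> A) A" by auto
  qed
  moreover have "finite (sym_diff (inv x <#\<^bsub>G\<^esub> A) A)" using A x by (simp add: left_commensurated_def)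
  ultimately show ?thesis by (rule finite_subset)
qed

text \<open>The last property says that \<open>D\<close> contains the boundary of \<open>A\<close> at each element of \<open>D\<close>. Each
  boundary is finite, so closing off under boundaries preserves countability.\<close>

lemma countable_subgroup_separating:
  assumes A: "left_commensurated G A" and inf: "infinite A" "infinite (carrier G - A)"
  obtains D where "countable D" "subgroup D G" "infinite (D \<inter> A)" "infinite (D - A)"
    "\<And>x y. x \<in> D \<Longrightarrow> y \<in> carrier G - D \<Longrightarrow> y \<in> A \<longleftrightarrow> x \<otimes> y \<in> A"
proof -
  have sub: "A \<subseteq> carrier G" using A by (simp add: left_commensurated_def)
  obtain S T where S: "S \<subseteq> A" "countable S" "infinite S"
    and T: "T \<subseteq> carrier G - A" "countable T" "infinite T"
    using infinite_countable_subset'[OF inf(1)] infinite_countable_subset'[OF inf(2)] by metis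
  define L where "L x = {y \<in> carrier G. (y \<in> A) \<noteq> (x \<otimes> y \<in> A)}" for x
  have "\<exists>D. countable D \<and> S \<union> T \<subseteq> D \<and> D \<subseteq> carrier G
      \<and> (\<forall>x\<in>D. \<forall>y\<in>D. {x \<otimes> y, inv x} \<union> L x \<subseteq> D)"
  proof (rule countable_closure)
    show "countable (S \<union> T)" "S \<union> T \<subseteq> carrier G" using S T sub by auto
    fix x y assume "x \<in> carrier G" "y \<in> carrier G"
    then show "countable ({x \<otimes> y, inv x} \<union> L x) \<and> {x \<otimes> y, inv x} \<union> L x \<subseteq> carrier G"
      using finite_boundary[OF A, of x] by (auto simp: L_def countable_finite)
  qed
  then obtain D where D: "countable D" "S \<union> T \<subseteq> D" "D \<subseteq> carrier G"
    and cl: "\<forall>x\<in>D. \<forall>y\<in>D. {x \<otimes> y, inv x} \<union> L x \<subseteq> D"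
    by (elim exE conjE)
  have ne: "D \<noteq> {}" using S(3) D(2) by auto
  show thesis
  proof
    show "countable D" by (rule D(1))
    show "subgroup D G"
    proof (rule subgroupI[OF D(3) ne])
      show "inv x \<in> D" if "x \<in> D" for x using cl that by blast
      show "x \<otimes> y \<in> D" if "x \<in> D" "y \<in> D" for x y using cl that by blast
    qed
    have "S \<subseteq> D \<inter> A" using S(1) D(2) by auto
    then show "infinite (D \<inter> A)" using S(3) finite_subset by blast
    have "T \<subseteq> D - A" using T(1) D(2) by auto
    then show "infinite (D - A)" using T(3) finite_subset by blast
    fix x y assume "x \<in> D" "y \<in> carrier G - D"
    moreover from this have "y \<notin> L x" using cl by blast
    ultimately show "y \<in> A \<longleftrightarrow> x \<otimes> y \<in> A" by (auto simp: L_def)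
  qed
qed

text \<open>If \<open>h\<close> is outside \<open>D g\<close>, then \<open>k = g (inv h)\<close> is outside the separating subgroup \<open>D\<close>, so that
  \<open>D k\<close> is contained in \<open>A\<close> or disjoint from it. If \<open>A h\<close> and \<open>A g\<close> were almost equal, then
  \<open>d \<in> A\<close> and \<open>d k \<in> A\<close> would be equivalent for all but finitely many \<open>d \<in> D\<close>, making \<open>D \<inter> A\<close> or
  \<open>D - A\<close> finite.\<close>

lemma countable_almost_equal_translates:
  assumes A: "left_commensurated G A" and inf: "infinite A" "infinite (carrier G - A)"
    and g: "g \<in> carrier G"
  shows "countable {h \<in> carrier G. finite (sym_diff (A #> h) (A #> g))}"
proof -
  have sub: "A \<subseteq> carrier G" using A by (simp add: left_commensurated_def)
  obtain D where D: "countable D" "subgroup D G" "infinite (D \<inter> A)" "infinite (D - A)"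
    and out: "\<And>x y. x \<in> D \<Longrightarrow> y \<in> carrier G - D \<Longrightarrow> y \<in> A \<longleftrightarrow> x \<otimes> y \<in> A"
    using countable_subgroup_separating[OF A inf] by metis
  interpret D: subgroup D G by (rule D(2))
  have "h \<in> (\<lambda>d. d \<otimes> g) ` D"
    if h: "h \<in> carrier G" and fin: "finite (sym_diff (A #> h) (A #> g))" for h
  proof (rule ccontr)
    define k where "k = g \<otimes> inv h"
    have k: "k \<in> carrier G" using g h by (simp add: k_def)
    assume no: "h \<notin> (\<lambda>d. d \<otimes> g) ` D"
    have "k \<notin> D"
    proof
      assume "k \<in> D"
      then have "inv k \<in> D" by (rule D.m_inv_closed)
      moreover have "h = inv k \<otimes> g" using g h by (simp add: k_def inv_mult_group m_assoc)
      ultimately show False using no by blast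
    qed
    have const: "d \<otimes> k \<in> A \<longleftrightarrow> k \<in> A" if "d \<in> D" for d
      using out[OF that] k \<open>k \<notin> D\<close> by simp
    have "finite {d \<in> D. (d \<in> A) \<noteq> (d \<otimes> k \<in> A)}"
    proof (rule finite_surj)
      show "finite (sym_diff (A #> h) (A #> g))" by (rule fin)
      \<comment> \<open>right multiplication by \<open>g\<close> turns \<open>d \<in> A\<close> and \<open>d k \<in> A\<close> into membership in \<open>A g\<close> and \<open>A h\<close>\<close>
      show "{d \<in> D. (d \<in> A) \<noteq> (d \<otimes> k \<in> A)}
        \<subseteq> (\<lambda>y. y \<otimes> inv g) ` sym_diff (A #> h) (A #> g)"
      proof
        fix d assume d: "d \<in> {d \<in> D. (d \<in> A) \<noteq> (d \<otimes> k \<in> A)}"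
        then have dc: "d \<in> carrier G" using D.subset by auto
        have "d \<otimes> g \<in> A #> g \<longleftrightarrow> d \<in> A" "d \<otimes> g \<in> A #> h \<longleftrightarrow> d \<otimes> k \<in> A"
          using mem_r_coset_iff[OF sub] dc g h by (auto simp: m_assoc k_def)
        then have "d \<otimes> g \<in> sym_diff (A #> h) (A #> g)" using d by auto
        moreover have "d = d \<otimes> g \<otimes> inv g" using dc g by (simp add: m_assoc)
        ultimately show "d \<in> (\<lambda>y. y \<otimes> inv g) ` sym_diff (A #> h) (A #> g)" by blast
      qed
    qed
    moreover have "{d \<in> D. (d \<in> A) \<noteq> (d \<otimes> k \<in> A)} = (if k \<in> A then D - A else D \<inter> A)"
      using const by auto
    ultimately show False using D(3,4) by (auto split: if_splits)
  qed
  then have "{h \<in> carrier G. finite (sym_diff (A #> h) (A #> g))} \<subseteq> (\<lambda>d. d \<otimes> g) ` D"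
    by auto
  then show ?thesis using D(1) by (meson countable_image countable_subset)
qed

end

section \<open>The algebra of ends\<close>

context group
begin

definition end_class :: "'a set \<Rightarrow> 'a set set" where
  "end_class A = finite_ideal G +>\<^bsub>comm_algebra G\<^esub> A"

lemma end_class_eq_iff:
  assumes "left_commensurated G A" "left_commensurated G B"
  shows "end_class A = end_class B \<longleftrightarrow> finite (sym_diff A B)"
proof -
  interpret P: cring "comm_algebra G" by (rule cring_comm_algebra)
  have carr: "A \<in> carrier (comm_algebra G)" "B \<in> carrier (comm_algebra G)"
    using assms by (auto simp: comm_algebra_def)
  have "\<ominus>\<^bsub>comm_algebra G\<^esub> B = B"
    by (rule P.minus_equality) (use assms in \<open>auto simp: comm_algebra_def\<close>)
  then have "A \<ominus>\<^bsub>comm_algebra G\<^esub> B = sym_diff A B"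
    by (simp add: a_minus_def comm_algebra_def)
  then show ?thesis
    using P.quotient_eq_iff_same_a_r_cos[OF ideal_finite_ideal carr] assms
    by (auto simp: end_class_def finite_ideal_def left_commensurated_def)
qed

lemma carrier_ends_algebra:
  "carrier (ends_algebra G) = end_class ` {A. left_commensurated G A}"
  by (auto simp: ends_algebra_def FactRing_def A_RCOSETS_def' end_class_def comm_algebra_def)

lemma boolean_ring_ends_algebra: "boolean_ring (ends_algebra G)"
proof -
  interpret Q: cring "ends_algebra G" by (rule cring_ends_algebra)
  show ?thesis
  proof unfold_locales
    fix a assume "a \<in> carrier (ends_algebra G)"
    then obtain A where A: "left_commensurated G A" "a = end_class A"
      by (auto simp: carrier_ends_algebra)
    then show "a \<otimes>\<^bsub>ends_algebra G\<^esub> a = a"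
      using ideal.rcoset_mult_add[OF ideal_finite_ideal, of A A]
      by (simp add: ends_algebra_def FactRing_def end_class_def) (simp add: comm_algebra_def)
  qed
qed

text \<open>If every left commensurated set were finite or cofinite, then the only classes would be those
  of the empty set and of the whole group.\<close>

lemma infinitely_ended_imp_separating_set:
  assumes "infinitely_ended G"
  obtains A where "left_commensurated G A" "infinite A" "infinite (carrier G - A)"
proof (rule ccontr)
  assume "\<not> thesis"
  with that have no: "finite A \<or> finite (carrier G - A)" if "left_commensurated G A" for A
    using that by blast
  have "end_class A \<in> {end_class {}, end_class (carrier G)}" if A: "left_commensurated G A" for A
  proof -
    have "finite (sym_diff A {}) \<or> finite (sym_diff A (carrier G))"
      using no[OF A] A by (auto simp: left_commensurated_def Diff_eq_empty_iff[THEN iffD2])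
    then show ?thesis
      using end_class_eq_iff[OF A left_commensurated_carrier]
        end_class_eq_iff[OF A left_commensurated_finite[of "{}"]] by auto
  qed
  then have "carrier (ends_algebra G) \<subseteq> {end_class {}, end_class (carrier G)}"
    by (auto simp: carrier_ends_algebra)
  then show False using assms finite_subset unfolding infinitely_ended_def by blast
qed

lemma card_ordLeq_ends_algebra:
  assumes "infinitely_ended G"
  shows "(card_of (carrier G), card_of (carrier (ends_algebra G))) \<in> ordLeq"
proof -
  let ?Q = "carrier (ends_algebra G)"
  have infQ: "infinite ?Q" using assms by (simp add: infinitely_ended_def)
  obtain A where A: "left_commensurated G A" "infinite A" "infinite (carrier G - A)"
    using infinitely_ended_imp_separating_set[OF assms] .
  \<comment> \<open>the fibres of \<open>h \<mapsto> [A h]\<close>\<close>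
  let ?F = "\<lambda>q. {h \<in> carrier G. end_class (A #> h) = q}"
  have "countable (?F q)" for q
  proof (cases "?F q = {}")
    case False
    then obtain g where g: "g \<in> carrier G" "end_class (A #> g) = q" by auto
    then have "?F q = {h \<in> carrier G. finite (sym_diff (A #> h) (A #> g))}"
      using end_class_eq_iff[OF left_commensurated_r_coset[OF A(1)]
          left_commensurated_r_coset[OF A(1)]]
      by blast
    then show ?thesis using countable_almost_equal_translates[OF A g(1)] by simp
  qed (simp only: countable_empty)
  then have "(card_of (?F q), card_of ?Q) \<in> ordLeq" for q
    using infQ by (meson countable_card_of_nat infinite_iff_card_of_nat ordLeq_transitive)
  then have "(card_of (\<Union>q\<in>?Q. ?F q), card_of ?Q) \<in> ordLeq"
    by (intro card_of_UNION_ordLeq_infinite[OF infQ ordLeq_refl[OF card_of_Card_order]] ballI)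
  moreover have "carrier G = (\<Union>q\<in>?Q. ?F q)"
    using left_commensurated_r_coset[OF A(1)] by (auto simp: carrier_ends_algebra)
  ultimately show ?thesis by simp
qed

end

section \<open>The end weight\<close>

theorem corollary1p17:
  fixes G :: "('a, 'b) monoid_scheme"
  assumes "group G"
    and "infinitely_ended G"
  shows "(card_of (carrier G), end_weight G) \<in> ordLeq"
proof -
  interpret group G by (rule assms(1))
  interpret E: boolean_ring "ends_algebra G" by (rule boolean_ring_ends_algebra)
  have "infinite (carrier (ends_algebra G))"
    using assms(2) by (simp add: infinitely_ended_def)
  then have "(card_of (carrier (ends_algebra G)), end_weight G) \<in> ordLeq"
    unfolding end_weight_def ends_space_def by (rule E.card_carrier_ordLeq_weight_stone_dual)
  with card_ordLeq_ends_algebra[OF assms(2)] show ?thesis by (rule ordLeq_transitive)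
qed

end
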